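(* Let the coefficient-free cluster pattern have $2\times 2$ exchange matrices ($n=2$). For each vertex $s$ of $\mathbb{T}_2$ let $B_s$ be its exchange matrix at $s$. Then: (Property D) for all vertices $t_0,t$: $\bigl(D_t^{B_{t_0};t_0}\bigr)^T=D_{t_0}^{(-B_t)^T;t}$; (Property R) for all vertices $t_0,t$ and $k\in\{1,2\}$, with $t_0\overset{k}{-}t_1$: $D_t^{B_{t_1};t_1}=J_kD_t^{B_{t_0};t_0}+\max\bigl([B_{t_0}^{k\bullet}]_+D_t^{B_{t_0};t_0},\ [-B_{t_0}^{k\bullet}]_+D_t^{B_{t_0};t_0}\bigr)$; (Property M) for all vertices $t_0,t$: $M_t^{B_{t_0};t_0}=-D_t^{B_{t_0};t_0}+\max\bigl([B_{t_0}]_+D_t^{B_{t_0};t_0},\ [-B_{t_0}]_+D_t^{B_{t_0};t_0}\bigr)$.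
   Context: $\mathbb{T}_n$ is the $n$-regular tree whose edges are labeled by $1,\dots,n$ so that the $n$ edges at each vertex have distinct labels; $t\overset{k}{-}t'$ means an edge labeled $k$. $[a]_+=\max(a,0)$. For a skew-symmetrizable integer matrix $B=(b_{ij})$, the mutation $\mu_k(B)=(b'_{ij})$ has $b'_{ij}=-b_{ij}$ if $i=k$ or $j=k$, and $b'_{ij}=b_{ij}+\mathrm{sgn}(b_{ik})[b_{ik}b_{kj}]_+$ otherwise. Given $B_0$ and a vertex $t_0$, the coefficient-free cluster pattern assigns to each vertex $t$ an exchange matrix $B_t^{B_0;t_0}=(b_{ij;t})$ and cluster $(x_{1;t},\dots,x_{n;t})$ in $\mathbb{Q}(x_1,\dots,x_n)$ with $B_{t_0}=B_0$, $x_{i;t_0}=x_i$, and for each edge $t\overset{k}{-}t'$: $B_{t'}=\mu_k(B_t)$, $x_{j;t'}=x_{j;t}$ ($j\ne k$), $x_{k;t'}x_{k;t}=\prod_\ell x_{\ell;t}^{[b_{\ell k;t}]_+}+\prod_\ell x_{\ell;t}^{[-b_{\ell k;t}]_+}$. Each $x_{j;t}^{B_0;t_0}$ is a Laurent polynomial in $x_1,\dots,x_n$. $D_t^{B_0;t_0}$ has $(i,j)$ entry equal to minus the lowest power of $x_i$ in the Laurent expansion of $x_{j;t}^{B_0;t_0}$ (columns are $\mathbf{d}$-vectors); $M_t^{B_0;t_0}$ has $(i,j)$ entry equal to the highest power of $x_i$ in that expansion. $A^{k\bullet}$ is $A$ with all entries outside row $k$ replaced by $0$; $J_k$ is the identity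 matrix with $(k,k)$ entry replaced by $-1$; $\max$, $[\cdot]_+$ act entrywise. *)

theory Defs
  imports
    "HOL-Analysis.Cartesian_Space"
    "HOL-Library.Numeral_Type"
    "HOL-Library.Poly_Mapping"
    "HOL-Computational_Algebra.Fraction_Field"
begin

section \<open>Regular trees with labeled edges\<close>

text \<open>\<open>E t k t'\<close> says that \<open>t\<close> and \<open>t'\<close> are joined by an edge labeled \<open>k\<close>.\<close>

primrec walk :: "('v \<Rightarrow> 'n \<Rightarrow> 'v \<Rightarrow> bool) \<Rightarrow> 'v \<Rightarrow> 'n list \<Rightarrow> 'v \<Rightarrow> bool" where
  "walk E t [] t' \<longleftrightarrow> t = t'"
| "walk E t (k # ks) t' \<longleftrightarrow> (\<exists>s. E t k s \<and> walk E s ks t')"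

text \<open>
  Since the edges at a vertex have distinct labels, a walk never backtracks iff no label is
  immediately repeated. A graph is a tree iff any two vertices are joined by exactly one walk
  without backtracking (this also excludes loops and multiple edges). Every label occurs at every
  vertex, so the tree is regular of degree equal to the number of labels.
\<close>

definition regular_labeled_tree :: "('v \<Rightarrow> 'n \<Rightarrow> 'v \<Rightarrow> bool) \<Rightarrow> bool" where
  "regular_labeled_tree E \<longleftrightarrow>
     (\<forall>t k t'. E t k t' \<longrightarrow> E t' k t) \<and>
     (\<forall>t k. \<exists>!t'. E t k t') \<and>
     (\<forall>t t'. \<exists>!ks. distinct_adj ks \<and> walk E t ks t')"

definition tree_path :: "('v \<Rightarrow> 'n \<Rightarrow> 'v \<Rightarrow> bool) \<Rightarrow> 'v \<Rightarrow> 'v \<Rightarrow> 'n list" where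
  "tree_path E t t' = (THE ks. distinct_adj ks \<and> walk E t ks t')"


section \<open>Matrices\<close>

type_synonym 'n int_mat = "((int, 'n) vec, 'n) vec"

definition skew_symmetrizable :: "'n::finite int_mat \<Rightarrow> bool" where
  "skew_symmetrizable B \<longleftrightarrow>
     (\<exists>d :: 'n \<Rightarrow> int. (\<forall>i. d i > 0) \<and> (\<forall>i j. d i * B $ i $ j = - (d j * B $ j $ i)))"

definition pos_part :: "int \<Rightarrow> int" where
  "pos_part a = max a 0"

definition mutate :: "'n::finite \<Rightarrow> 'n int_mat \<Rightarrow> 'n int_mat" where
  "mutate k B = (\<chi> i j. if i = k \<or> j = k then - B $ i $ j
                       else B $ i $ j + sgn (B $ i $ k) * pos_part (B $ i $ k * B $ k $ j))"

definition mat_pos_part :: "'n::finite int_mat \<Rightarrow> 'n int_mat" where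
  "mat_pos_part A = (\<chi> i j. pos_part (A $ i $ j))"

definition mat_max :: "'n::finite int_mat \<Rightarrow> 'n int_mat \<Rightarrow> 'n int_mat" where
  "mat_max A A' = (\<chi> i j. max (A $ i $ j) (A' $ i $ j))"

definition row_only :: "'n::finite \<Rightarrow> 'n int_mat \<Rightarrow> 'n int_mat" where
  "row_only k A = (\<chi> i j. if i = k then A $ i $ j else 0)"

definition J_mat :: "'n::finite \<Rightarrow> 'n int_mat" where
  "J_mat k = (\<chi> i j. if i = j then (if i = k then - 1 else 1) else 0)"


section \<open>Laurent polynomials and rational functions\<close>

text \<open>
  A Laurent polynomial over the rationals is a finitely supported map from integer exponent
  vectors to coefficients. The fraction field of the Laurent polynomial ring is the field
  of rational functions in the same variables. The order on \<open>'n\<close> is needed only because the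
  library's integral domain instance for \<open>\<Rightarrow>\<^sub>0\<close> asks for a linear order on exponent vectors.
\<close>

type_synonym 'n laurent_poly = "('n \<Rightarrow>\<^sub>0 int) \<Rightarrow>\<^sub>0 rat"

type_synonym 'n rat_fun = "'n laurent_poly fract"

definition indet :: "'n::linorder \<Rightarrow> 'n rat_fun" where
  "indet i = Fract (Poly_Mapping.single (Poly_Mapping.single i 1) 1) 1"

definition laurent_expansion :: "'n::linorder rat_fun \<Rightarrow> 'n laurent_poly" where
  "laurent_expansion f = (THE p. f = Fract p 1)"

definition lowest_power :: "'n \<Rightarrow> 'n laurent_poly \<Rightarrow> int" where
  "lowest_power i p = Min ((\<lambda>a. Poly_Mapping.lookup a i) ` Poly_Mapping.keys p)"

definition highest_power :: "'n \<Rightarrow> 'n laurent_poly \<Rightarrow> int" where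
  "highest_power i p = Max ((\<lambda>a. Poly_Mapping.lookup a i) ` Poly_Mapping.keys p)"


section \<open>Coefficient-free cluster patterns\<close>

type_synonym 'n seed = "'n int_mat \<times> ('n \<Rightarrow> 'n rat_fun)"

definition exchange_rhs ::
    "'n::{finite,linorder} \<Rightarrow> 'n int_mat \<Rightarrow> ('n \<Rightarrow> 'n rat_fun) \<Rightarrow> 'n rat_fun" where
  "exchange_rhs k B x =
     (\<Prod>l\<in>UNIV. x l ^ nat (pos_part (B $ l $ k))) + (\<Prod>l\<in>UNIV. x l ^ nat (pos_part (- B $ l $ k)))"

definition mutate_seed :: "'n::{finite,linorder} \<Rightarrow> 'n seed \<Rightarrow> 'n seed" where
  "mutate_seed k = (\<lambda>(B, x). (mutate k B, x(k := exchange_rhs k B x / x k)))"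

text \<open>
  The seed at \<open>t\<close> is obtained from the initial seed at \<open>t0\<close> by mutating along the path from \<open>t0\<close>
  to \<open>t\<close>. The lemmas \<open>seed_initial\<close>, \<open>exch_mat_edge\<close>, \<open>cluster_var_edge_other\<close> and
  \<open>cluster_var_edge\<close> below show that the resulting family satisfies the conditions that
  define a cluster pattern.
\<close>

definition seed ::
    "('v \<Rightarrow> 'n::{finite,linorder} \<Rightarrow> 'v \<Rightarrow> bool) \<Rightarrow> 'n int_mat \<Rightarrow> 'v \<Rightarrow> 'v \<Rightarrow> 'n seed" where
  "seed E B0 t0 t = fold mutate_seed (tree_path E t0 t) (B0, indet)"

definition exch_mat ::
    "('v \<Rightarrow> 'n::{finite,linorder} \<Rightarrow> 'v \<Rightarrow> bool) \<Rightarrow> 'n int_mat \<Rightarrow> 'v \<Rightarrow> 'v \<Rightarrow> 'n int_mat" where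
  "exch_mat E B0 t0 t = fst (seed E B0 t0 t)"

definition cluster_var ::
    "('v \<Rightarrow> 'n::{finite,linorder} \<Rightarrow> 'v \<Rightarrow> bool) \<Rightarrow> 'n int_mat \<Rightarrow> 'v \<Rightarrow> 'v \<Rightarrow> 'n \<Rightarrow> 'n rat_fun" where
  "cluster_var E B0 t0 t j = snd (seed E B0 t0 t) j"

definition D_mat ::
    "('v \<Rightarrow> 'n::{finite,linorder} \<Rightarrow> 'v \<Rightarrow> bool) \<Rightarrow> 'n int_mat \<Rightarrow> 'v \<Rightarrow> 'v \<Rightarrow> 'n int_mat" where
  "D_mat E B0 t0 t =
     (\<chi> i j. - lowest_power i (laurent_expansion (cluster_var E B0 t0 t j)))"

definition M_mat ::
    "('v \<Rightarrow> 'n::{finite,linorder} \<Rightarrow> 'v \<Rightarrow> bool) \<Rightarrow> 'n int_mat \<Rightarrow> 'v \<Rightarrow> 'v \<Rightarrow> 'n int_mat" where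
  "M_mat E B0 t0 t =
     (\<chi> i j. highest_power i (laurent_expansion (cluster_var E B0 t0 t j)))"


section \<open>The defining conditions hold\<close>

lemma tree_path_eqI:
  assumes "regular_labeled_tree E" "distinct_adj ks" "walk E t ks t'"
  shows "tree_path E t t' = ks"
proof -
  have "\<exists>!ks. distinct_adj ks \<and> walk E t ks t'"
    using assms(1) unfolding regular_labeled_tree_def by blast
  then show ?thesis
    unfolding tree_path_def by (rule the1_equality) (use assms in auto)
qed

lemma tree_path:
  assumes "regular_labeled_tree E"
  shows "distinct_adj (tree_path E t t')" "walk E t (tree_path E t t') t'"
proof -
  have "\<exists>!ks. distinct_adj ks \<and> walk E t ks t'"
    using assms unfolding regular_labeled_tree_def by blast
  from theI'[OF this] show "distinct_adj (tree_path E t t')" "walk E t (tree_path E t t') t'"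
    unfolding tree_path_def by auto
qed

lemma walk_snoc: "walk E t (ks @ [k]) t' \<longleftrightarrow> (\<exists>s. walk E t ks s \<and> E s k t')"
  by (induction ks arbitrary: t) auto

lemma seed_initial:
  assumes "regular_labeled_tree E"
  shows "exch_mat E B0 t0 t0 = B0" "cluster_var E B0 t0 t0 = indet"
proof -
  have "tree_path E t0 t0 = []"
    by (rule tree_path_eqI[OF assms]) auto
  then show "exch_mat E B0 t0 t0 = B0" "cluster_var E B0 t0 t0 = indet"
    by (auto simp: exch_mat_def cluster_var_def seed_def)
qed

lemma skew_symmetrizable_mutate:
  fixes B :: "'n::finite int_mat"
  assumes "skew_symmetrizable B"
  shows "skew_symmetrizable (mutate k B)"
proof -
  obtain d :: "'n \<Rightarrow> int" where d: "\<And>i. d i > 0"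
    and B: "\<And>i j. d i * B $ i $ j = - (d j * B $ j $ i)"
    using assms unfolding skew_symmetrizable_def by blast
  have sg: "sgn (B $ i $ j) = - sgn (B $ j $ i)" for i j
  proof -
    have "sgn (d i * B $ i $ j) = - sgn (d j * B $ j $ i)"
      unfolding B[of i j] by (simp add: sgn_if)
    then show ?thesis using d by (simp add: sgn_mult)
  qed
  have eq: "d i * (sgn (B $ i $ k) * pos_part (B $ i $ k * B $ k $ j)) =
        - (d j * (sgn (B $ j $ k) * pos_part (B $ j $ k * B $ k $ i)))" for i j
  proof -
    have e: "d i * (B $ i $ k * B $ k $ j) = d j * (B $ j $ k * B $ k $ i)"
    proof -
      have "d i * (B $ i $ k * B $ k $ j) = (d i * B $ i $ k) * B $ k $ j" by simp
      also have "\<dots> = - (d k * B $ k $ j) * B $ k $ i" unfolding B[of i k] by simp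
      also have "\<dots> = (d j * B $ j $ k) * B $ k $ i" unfolding B[of k j] by simp
      finally show ?thesis by simp
    qed
    have p: "d i * pos_part (B $ i $ k * B $ k $ j) = d j * pos_part (B $ j $ k * B $ k $ i)"
    proof -
      have "a * pos_part b = pos_part (a * b)" if "a > 0" for a b :: int
        using that by (simp add: pos_part_def max_def zero_less_mult_iff mult_le_0_iff)
      then show ?thesis using e d by simp
    qed
    show ?thesis
    proof (cases "B $ i $ k * B $ k $ j > 0")
      case True
      then have "sgn (B $ i $ k) = sgn (B $ k $ j)"
        by (auto simp: zero_less_mult_iff)
      then have "sgn (B $ i $ k) = - sgn (B $ j $ k)" using sg[of k j] by simp
      then show ?thesis using p by (simp add: mult.left_commute)
    next
      case False
      then have z: "pos_part (B $ i $ k * B $ k $ j) = 0" by (simp add: pos_part_def)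
      with p d[of j] have "pos_part (B $ j $ k * B $ k $ i) = 0" by simp
      with z show ?thesis by simp
    qed
  qed
  have "d i * mutate k B $ i $ j = - (d j * mutate k B $ j $ i)" for i j
    using B[of i j] eq[of i j] by (auto simp: mutate_def algebra_simps)
  with d show ?thesis unfolding skew_symmetrizable_def by blast
qed

lemma skew_symmetrizable_diag:
  fixes B :: "'n::finite int_mat"
  assumes "skew_symmetrizable B"
  shows "B $ i $ i = 0"
proof -
  obtain d :: "'n \<Rightarrow> int" where "d i > 0" "d i * B $ i $ i = - (d i * B $ i $ i)"
    using assms unfolding skew_symmetrizable_def by blast
  then show ?thesis by auto
qed

lemma mutate_mutate: "mutate k (mutate k B) = B"
  by (auto simp: mutate_def vec_eq_iff sgn_minus)

lemma exchange_rhs_mutate: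
  assumes "skew_symmetrizable B"
  shows "exchange_rhs k (mutate k B) (x(k := y)) = exchange_rhs k B x"
proof -
  have "(\<Prod>l\<in>UNIV. (x(k := y)) l ^ nat (pos_part (c * B $ l $ k))) =
        (\<Prod>l\<in>UNIV. x l ^ nat (pos_part (c * B $ l $ k)))" for c
    by (rule prod.cong) (auto simp: skew_symmetrizable_diag[OF assms] pos_part_def)
  from this[of 1] this[of "-1"] show ?thesis
    by (simp add: exchange_rhs_def mutate_def add.commute)
qed

text \<open>Cluster variables are nonzero because they are subtraction-free.\<close>

definition nonneg :: "('a \<Rightarrow>\<^sub>0 rat) \<Rightarrow> bool" where
  "nonneg p \<longleftrightarrow> (\<forall>a. Poly_Mapping.lookup p a \<ge> 0)"

definition subtraction_free :: "'n::linorder rat_fun \<Rightarrow> bool" where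
  "subtraction_free f \<longleftrightarrow> (\<exists>p q. nonneg p \<and> p \<noteq> 0 \<and> nonneg q \<and> q \<noteq> 0 \<and> f = Fract p q)"

lemma nonneg_add: "nonneg p \<Longrightarrow> nonneg q \<Longrightarrow> nonneg (p + q)"
  by (simp add: nonneg_def lookup_add)

lemma nonneg_add_nonzero:
  assumes "nonneg p" "nonneg q" "p \<noteq> 0"
  shows "p + q \<noteq> 0"
proof
  assume "p + q = 0"
  then have "Poly_Mapping.lookup p a + Poly_Mapping.lookup q a = 0" for a
    by (metis lookup_add lookup_zero)
  then have "Poly_Mapping.lookup p a = 0" for a
    using assms(1,2) unfolding nonneg_def by (metis add_nonneg_eq_0_iff)
  then have "p = 0" by (simp add: poly_mapping_eqI)
  with assms(3) show False by simp
qed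

lemma nonneg_mult:
  fixes p q :: "'a::monoid_add \<Rightarrow>\<^sub>0 rat"
  assumes "nonneg p" "nonneg q"
  shows "nonneg (p * q)"
  using assms unfolding nonneg_def
  by (auto simp: times_poly_mapping.rep_eq prod_fun_def Sum_any.expand_set when_def
           intro!: sum_nonneg mult_nonneg_nonneg)

lemma subtraction_free_nonzero: "subtraction_free f \<Longrightarrow> f \<noteq> 0"
  by (auto simp: subtraction_free_def Zero_fract_def eq_fract)

lemma subtraction_free_one: "subtraction_free 1"
  unfolding subtraction_free_def One_fract_def
  by (intro exI[of _ 1]) (auto simp: nonneg_def lookup_one when_def)

lemma subtraction_free_indet: "subtraction_free (indet i)"
  unfolding subtraction_free_def indet_def
  by (rule exI, rule exI[of _ 1])
     (auto simp: nonneg_def lookup_one lookup_single when_def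
           dest: arg_cong[where f = "\<lambda>p. Poly_Mapping.lookup p (Poly_Mapping.single i 1)"])

lemma subtraction_free_mult:
  assumes "subtraction_free f" "subtraction_free g"
  shows "subtraction_free (f * g)"
proof -
  obtain p q p' q' where
    "nonneg p" "p \<noteq> 0" "nonneg q" "q \<noteq> 0" "f = Fract p q"
    "nonneg p'" "p' \<noteq> 0" "nonneg q'" "q' \<noteq> 0" "g = Fract p' q'"
    using assms unfolding subtraction_free_def by auto
  then show ?thesis
    unfolding subtraction_free_def
    by (intro exI[of _ "p * p'"] exI[of _ "q * q'"]) (simp add: nonneg_mult)
qed

lemma subtraction_free_divide:
  assumes "subtraction_free f" "subtraction_free g"
  shows "subtraction_free (f / g)"
proof -
  obtain p q p' q' where
    "nonneg p" "p \<noteq> 0" "nonneg q" "q \<noteq> 0" "f = Fract p q"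
    "nonneg p'" "p' \<noteq> 0" "nonneg q'" "q' \<noteq> 0" "g = Fract p' q'"
    using assms unfolding subtraction_free_def by auto
  then show ?thesis
    unfolding subtraction_free_def
    by (intro exI[of _ "p * q'"] exI[of _ "q * p'"]) (simp add: nonneg_mult)
qed

lemma subtraction_free_add:
  assumes "subtraction_free f" "subtraction_free g"
  shows "subtraction_free (f + g)"
proof -
  obtain p q p' q' where
    "nonneg p" "p \<noteq> 0" "nonneg q" "q \<noteq> 0" "f = Fract p q"
    "nonneg p'" "p' \<noteq> 0" "nonneg q'" "q' \<noteq> 0" "g = Fract p' q'"
    using assms unfolding subtraction_free_def by auto
  then show ?thesis
    unfolding subtraction_free_def
    by (intro exI[of _ "p * q' + p' * q"] exI[of _ "q * q'"]) (simp add: nonneg_mult nonneg_add nonneg_add_nonzero)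
qed

lemma subtraction_free_power: "subtraction_free f \<Longrightarrow> subtraction_free (f ^ m)"
  by (induction m) (auto simp: subtraction_free_one subtraction_free_mult)

lemma subtraction_free_prod:
  "(\<And>l. l \<in> A \<Longrightarrow> subtraction_free (f l)) \<Longrightarrow> subtraction_free (\<Prod>l\<in>A. f l)"
  by (induction A rule: infinite_finite_induct)
     (auto simp: subtraction_free_one subtraction_free_mult)

definition good_seed :: "'n::{finite,linorder} seed \<Rightarrow> bool" where
  "good_seed s \<longleftrightarrow> skew_symmetrizable (fst s) \<and> (\<forall>i. subtraction_free (snd s i))"

lemma good_seed_mutate: "good_seed s \<Longrightarrow> good_seed (mutate_seed k s)"
  by (auto simp: good_seed_def mutate_seed_def exchange_rhs_def skew_symmetrizable_mutate
      split: prod.splits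
      intro!: subtraction_free_divide subtraction_free_add subtraction_free_prod
        subtraction_free_power)

lemma good_seed_fold: "good_seed s \<Longrightarrow> good_seed (fold mutate_seed ks s)"
  by (induction ks arbitrary: s) (auto simp: good_seed_mutate)

lemma good_seed_seed:
  assumes "skew_symmetrizable B0"
  shows "good_seed (seed E B0 t0 t)"
  unfolding seed_def
  by (rule good_seed_fold) (simp add: good_seed_def assms subtraction_free_indet)

lemma mutate_seed_mutate_seed:
  assumes "good_seed s"
  shows "mutate_seed k (mutate_seed k s) = s"
proof (cases s)
  case (Pair B x)
  have B: "skew_symmetrizable B" and x: "\<And>i. subtraction_free (x i)"
    using assms by (auto simp: good_seed_def Pair)
  have "subtraction_free (exchange_rhs k B x)"
    unfolding exchange_rhs_def
    by (intro subtraction_free_add subtraction_free_prod subtraction_free_power x)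
  then have "exchange_rhs k B x \<noteq> 0" by (rule subtraction_free_nonzero)
  then show ?thesis
    by (simp add: Pair mutate_seed_def mutate_mutate exchange_rhs_mutate[OF B])
qed

lemma seed_edge:
  assumes E: "regular_labeled_tree E" and B0: "skew_symmetrizable B0" and e: "E t k t'"
  shows "seed E B0 t0 t' = mutate_seed k (seed E B0 t0 t)"
proof -
  let ?p = "tree_path E t0 t"
  note p = tree_path[OF E, of t0 t]
  show ?thesis
  proof (cases "?p \<noteq> [] \<and> last ?p = k")
    case False
    then have "distinct_adj (?p @ [k])" using p(1) by (auto simp: distinct_adj_append_iff)
    moreover have "walk E t0 (?p @ [k]) t'" using p(2) e by (auto simp: walk_snoc)
    ultimately have "tree_path E t0 t' = ?p @ [k]" by (intro tree_path_eqI[OF E])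
    then show ?thesis by (simp add: seed_def)
  next
    case True
    then obtain q where q: "?p = q @ [k]" by (metis append_butlast_last_id)
    with p(2) obtain s where s: "walk E t0 q s" "E s k t" by (auto simp: walk_snoc)
    have "E t k s" using s(2) E unfolding regular_labeled_tree_def by blast
    then have "s = t'" using e E unfolding regular_labeled_tree_def by blast
    moreover have "distinct_adj q" using p(1) unfolding q by (rule distinct_adj_appendD1)
    ultimately have "tree_path E t0 t' = q" using s(1) by (intro tree_path_eqI[OF E]) auto
    then have "seed E B0 t0 t = mutate_seed k (seed E B0 t0 t')"
      by (simp add: seed_def q)
    then show ?thesis by (simp add: mutate_seed_mutate_seed good_seed_seed[OF B0])
  qed
qed

lemma exch_mat_edge:
  assumes "regular_labeled_tree E" "skew_symmetrizable B0" "E t k t'"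
  shows "exch_mat E B0 t0 t' = mutate k (exch_mat E B0 t0 t)"
  using seed_edge[OF assms, of t0] by (simp add: exch_mat_def mutate_seed_def split: prod.splits)

lemma cluster_var_edge_other:
  assumes "regular_labeled_tree E" "skew_symmetrizable B0" "E t k t'" "j \<noteq> k"
  shows "cluster_var E B0 t0 t' j = cluster_var E B0 t0 t j"
  using seed_edge[OF assms(1-3), of t0] assms(4)
  by (simp add: cluster_var_def mutate_seed_def split: prod.splits)

lemma cluster_var_edge:
  assumes "regular_labeled_tree E" "skew_symmetrizable B0" "E t k t'"
  shows "cluster_var E B0 t0 t' k * cluster_var E B0 t0 t k =
    (\<Prod>l\<in>UNIV. cluster_var E B0 t0 t l ^ nat (pos_part (exch_mat E B0 t0 t $ l $ k))) +
    (\<Prod>l\<in>UNIV. cluster_var E B0 t0 t l ^ nat (pos_part (- exch_mat E B0 t0 t $ l $ k)))"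
proof -
  have "subtraction_free (snd (seed E B0 t0 t) k)"
    using good_seed_seed[OF assms(2), of E t0 t] by (auto simp: good_seed_def)
  then have "snd (seed E B0 t0 t) k \<noteq> 0" by (rule subtraction_free_nonzero)
  then show ?thesis
    using seed_edge[OF assms, of t0]
    by (simp add: cluster_var_def exch_mat_def mutate_seed_def exchange_rhs_def split: prod.splits)
qed

text \<open>The doubly infinite path with alternating labels is a 2-regular labeled tree.\<close>

definition path_label :: "int \<Rightarrow> 2" where
  "path_label m = (if even m then 2 else 1)"

definition int_path :: "int \<Rightarrow> 2 \<Rightarrow> int \<Rightarrow> bool" where
  "int_path m k m' \<longleftrightarrow> (m' = m + 1 \<and> k = path_label m) \<or> (m' = m - 1 \<and> k = path_label m')"

lemma path_label_cases: "k = path_label m \<or> k = path_label (m - 1)"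
  using exhaust_2[of k] by (auto simp: path_label_def)

lemma path_label_neq: "path_label (m - 1) \<noteq> path_label m"
  by (simp add: path_label_def)

lemma int_path_up:
  "distinct_adj ks \<Longrightarrow> walk int_path s ks t \<Longrightarrow> ks = [] \<or> hd ks = path_label s \<Longrightarrow>
   s \<le> t \<and> ks = map path_label [s..t - 1]"
proof (induction ks arbitrary: s)
  case (Cons k ks)
  have k: "k = path_label s" using Cons.prems(3) by simp
  from Cons.prems(2) obtain r where r: "int_path s k r" "walk int_path r ks t" by auto
  have "r = s + 1" using r(1) path_label_neq[of s] unfolding int_path_def k by metis
  with r(2) have w: "walk int_path (s + 1) ks t" by simp
  have "ks = [] \<or> hd ks = path_label (s + 1)"
    using Cons.prems(1) k path_label_cases[of "hd ks" "s + 1"] unfolding distinct_adj_Cons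
    by (metis add_diff_cancel_right')
  with Cons.IH[OF distinct_adj_ConsD[OF Cons.prems(1)] w]
  have "s + 1 \<le> t" "ks = map path_label [s + 1..t - 1]" by auto
  moreover from this have "[s..t - 1] = s # [s + 1..t - 1]" by (intro upto_rec1) simp
  ultimately show ?case using k by simp
qed auto

lemma int_path_down:
  "distinct_adj ks \<Longrightarrow> walk int_path s ks t \<Longrightarrow> ks = [] \<or> hd ks = path_label (s - 1) \<Longrightarrow>
   t \<le> s \<and> ks = map path_label (rev [t..s - 1])"
proof (induction ks arbitrary: s)
  case (Cons k ks)
  have k: "k = path_label (s - 1)" using Cons.prems(3) by simp
  from Cons.prems(2) obtain r where r: "int_path s k r" "walk int_path r ks t" by auto
  have "r = s - 1" using r(1) path_label_neq[of s] unfolding int_path_def k by metis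
  with r(2) have w: "walk int_path (s - 1) ks t" by simp
  have "ks = [] \<or> hd ks = path_label (s - 1 - 1)"
    using Cons.prems(1) k path_label_cases[of "hd ks" "s - 1"] unfolding distinct_adj_Cons
    by metis
  with Cons.IH[OF distinct_adj_ConsD[OF Cons.prems(1)] w]
  have "t \<le> s - 1" "ks = map path_label (rev [t..s - 1 - 1])" by auto
  moreover from this have "[t..s - 1] = [t..s - 1 - 1] @ [s - 1]" by (intro upto_rec2) simp
  ultimately show ?case using k by simp
qed auto

lemma int_path_walk_up:
  "distinct_adj (map path_label [s..s + int m - 1]) \<and>
   walk int_path s (map path_label [s..s + int m - 1]) (s + int m)"
proof (induction m)
  case (Suc m)
  let ?xs = "map path_label [s..s + int m - 1]"
  have "[s..s + int m] = [s..s + int m - 1] @ [s + int m]" by (intro upto_rec2) simp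
  then have eq: "map path_label [s..s + int (Suc m) - 1] = ?xs @ [path_label (s + int m)]"
    by simp
  have "?xs = [] \<or> last ?xs \<noteq> path_label (s + int m)"
  proof (cases m)
    case (Suc m')
    have "[s..s + int m'] = [s..s + int m' - 1] @ [s + int m']" by (intro upto_rec2) simp
    then have "last ?xs = path_label (s + int m - 1)" using Suc by simp
    then show ?thesis using path_label_neq[of "s + int m"] by simp
  qed simp
  with Suc.IH have "distinct_adj (?xs @ [path_label (s + int m)])"
    by (auto simp only: distinct_adj_append_iff list.sel distinct_adj_singleton)
  moreover have "int_path (s + int m) (path_label (s + int m)) (s + int (Suc m))"
    by (simp add: int_path_def)
  ultimately show ?case
    using Suc.IH unfolding eq walk_snoc by blast
qed simp

lemma walk_sym:
  assumes sym: "\<And>t k t'. E t k t' \<Longrightarrow> E t' k t"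
  shows "walk E t ks t' \<Longrightarrow> walk E t' (rev ks) t"
proof (induction ks arbitrary: t)
  case (Cons k ks)
  then obtain s where s: "E t k s" "walk E s ks t'" by auto
  from Cons.IH[OF s(2)] sym[OF s(1)] show ?case by (auto simp: walk_snoc)
qed simp

lemma regular_labeled_tree_int_path: "regular_labeled_tree int_path"
proof -
  have sym: "int_path t k t' \<Longrightarrow> int_path t' k t" for t k t'
    by (auto simp: int_path_def)
  have nbr: "\<exists>!t'. int_path t k t'" for t k
  proof (cases "k = path_label t")
    case True
    with path_label_neq[of t] show ?thesis
      by (intro ex1I[of _ "t + 1"]) (auto simp: int_path_def)
  next
    case False
    with path_label_cases[of k t] have "k \<noteq> path_label t" "k = path_label (t - 1)" by auto
    then show ?thesis
      unfolding int_path_def by metis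
  qed
  have ex: "\<exists>ks. distinct_adj ks \<and> walk int_path s ks t" for s t
  proof (cases "s \<le> t")
    case True
    then show ?thesis using int_path_walk_up[of s "nat (t - s)"] by auto
  next
    case False
    then have d: "distinct_adj (map path_label [t..s - 1])"
        and w: "walk int_path t (map path_label [t..s - 1]) s"
      using int_path_walk_up[of t "nat (s - t)"] by auto
    have "walk int_path s (rev (map path_label [t..s - 1])) t"
      by (rule walk_sym[OF sym w])
    moreover have "distinct_adj (rev (map path_label [t..s - 1]))"
      using d unfolding distinct_adj_rev .
    ultimately show ?thesis by blast
  qed
  have un: "ks = ks'"
    if ks: "distinct_adj ks" "walk int_path s ks t"
      and ks': "distinct_adj ks'" "walk int_path s ks' t"
    for ks ks' s t
  proof -
    have *: "(s \<le> t \<and> zs = map path_label [s..t - 1]) \<or>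
             (t \<le> s \<and> zs = map path_label (rev [t..s - 1]))"
      if "distinct_adj zs" "walk int_path s zs t" for zs
      using int_path_up[OF that] int_path_down[OF that] path_label_cases[of "hd zs" s] by blast
    show ?thesis using *[OF ks] *[OF ks'] by (cases s t rule: linorder_cases) auto
  qed
  show ?thesis
    unfolding regular_labeled_tree_def
    by (intro conjI allI impI nbr, erule sym, intro ex_ex1I ex) (blast intro: un)
qed

end

theory Submission
  imports Defs
begin

text \<open>
  Cluster variables are subtraction-free, so lowest and highest powers of \<open>x\<^sub>i\<close> obey the tropical
  exchange relation \<open>u\<^sub>k' = max (|b\<^sub>l\<^sub>k| u\<^sub>l) 0 - u\<^sub>k\<close>. In rank 2 mutation only negates the exchange
  matrix, so the exponents are constant along the tree, and all denominator vectors are given by a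
  single integer recursion whose even terms are symmetric in \<open>|b\<^sub>1\<^sub>2|\<close> and \<open>|b\<^sub>2\<^sub>1|\<close>. This symmetry is
  Property D. Property R is the transpose of the terminal tropical recursion under D, and row \<open>i\<close>
  of Property M is row \<open>i\<close> of Property R for \<open>k = i\<close>, because a variable \<open>x\<^sub>i\<close> is tropically the
  inverse of its neighbour \<open>x\<^sub>i'\<close> at the start.
\<close>

section \<open>Monomial valuations\<close>

text \<open>With \<open>w\<close> the exponent of one variable or its negative, lowest and highest
  powers both become minima.\<close>

definition min_weight :: "('a \<Rightarrow> int) \<Rightarrow> ('a \<Rightarrow>\<^sub>0 rat) \<Rightarrow> int" where
  "min_weight w p = Min (w ` Poly_Mapping.keys p)"

lemma min_weight_le: "a \<in> Poly_Mapping.keys p \<Longrightarrow> min_weight w p \<le> w a"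
  by (simp add: min_weight_def)

lemma min_weight_eqI:
  assumes "a \<in> Poly_Mapping.keys p" "w a = m" "\<And>b. b \<in> Poly_Mapping.keys p \<Longrightarrow> m \<le> w b"
  shows "min_weight w p = m"
  unfolding min_weight_def using assms by (intro Min_eqI) auto

text \<open>Every other summand of the convolution has a zero factor, so nothing can cancel the
  product of these two coefficients.\<close>

lemma lookup_mult_unique:
  fixes p q :: "'a::monoid_add \<Rightarrow>\<^sub>0 'b::semiring_0"
  assumes "\<And>a' b'. a' \<in> Poly_Mapping.keys p \<Longrightarrow> b' \<in> Poly_Mapping.keys q \<Longrightarrow>
      a + b = a' + b' \<Longrightarrow> a' = a \<and> b' = b"
  shows "Poly_Mapping.lookup (p * q) (a + b) = Poly_Mapping.lookup p a * Poly_Mapping.lookup q b"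
proof -
  have "Poly_Mapping.lookup (p * q) (a + b) =
      (\<Sum>(a', b'). Poly_Mapping.lookup p a' * Poly_Mapping.lookup q b' when a + b = a' + b')"
    unfolding times_poly_mapping.rep_eq by (rule prod_fun_unfold_prod) auto
  also have "\<dots> = (\<Sum>ab.
      Poly_Mapping.lookup p (fst ab) * Poly_Mapping.lookup q (snd ab) when (a, b) = ab)"
  proof (rule Sum_any.cong)
    fix ab :: "'a \<times> 'a"
    obtain a' b' where ab: "ab = (a', b')" by (cases ab)
    have "Poly_Mapping.lookup p a' * Poly_Mapping.lookup q b' = 0"
      if "a + b = a' + b'" "(a, b) \<noteq> (a', b')"
      using that assms[of a' b']
      by (cases "Poly_Mapping.lookup p a' = 0"; cases "Poly_Mapping.lookup q b' = 0")
         (auto simp: in_keys_iff)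
    then show "(case ab of (a', b') \<Rightarrow>
          Poly_Mapping.lookup p a' * Poly_Mapping.lookup q b' when a + b = a' + b') =
        (Poly_Mapping.lookup p (fst ab) * Poly_Mapping.lookup q (snd ab) when (a, b) = ab)"
      by (auto simp: ab when_def)
  qed
  also have "\<dots> = Poly_Mapping.lookup p a * Poly_Mapping.lookup q b"
    by simp
  finally show ?thesis .
qed

text \<open>
  Breaking ties of the weight by the linear order on exponents singles out one term of each factor,
  and the product of these two terms cannot cancel.
\<close>

lemma min_weight_mult:
  fixes p q :: "'a::{ordered_cancel_comm_monoid_add, linorder} \<Rightarrow>\<^sub>0 rat"
  assumes w: "\<And>a b. w (a + b) = w a + w b" and "p \<noteq> 0" "q \<noteq> 0"
  shows "min_weight w (p * q) = min_weight w p + min_weight w q"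
proof -
  have ex: "\<exists>a. a \<in> Poly_Mapping.keys r \<and> w a = min_weight w r \<and>
      (\<forall>b \<in> Poly_Mapping.keys r. w b = w a \<longrightarrow> a \<le> b)"
    if "r \<noteq> 0" for r :: "'a \<Rightarrow>\<^sub>0 rat"
  proof -
    let ?S = "{a \<in> Poly_Mapping.keys r. w a = min_weight w r}"
    have "min_weight w r \<in> w ` Poly_Mapping.keys r"
      unfolding min_weight_def using that by (intro Min_in) auto
    then have "?S \<noteq> {}" by auto
    moreover have "finite ?S" by simp
    ultimately have "Min ?S \<in> ?S" "\<forall>b\<in>?S. Min ?S \<le> b" by (auto simp del: mem_Collect_eq)
    then show ?thesis by (intro exI[of _ "Min ?S"]) auto
  qed
  obtain a where a: "a \<in> Poly_Mapping.keys p" "w a = min_weight w p"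
      "\<And>b. b \<in> Poly_Mapping.keys p \<Longrightarrow> w b = w a \<Longrightarrow> a \<le> b"
    using ex[OF \<open>p \<noteq> 0\<close>] by blast
  obtain b where b: "b \<in> Poly_Mapping.keys q" "w b = min_weight w q"
      "\<And>c. c \<in> Poly_Mapping.keys q \<Longrightarrow> w c = w b \<Longrightarrow> b \<le> c"
    using ex[OF \<open>q \<noteq> 0\<close>] by blast
  have "Poly_Mapping.lookup (p * q) (a + b) = Poly_Mapping.lookup p a * Poly_Mapping.lookup q b"
  proof (rule lookup_mult_unique)
    fix a' b' assume 1: "a' \<in> Poly_Mapping.keys p" "b' \<in> Poly_Mapping.keys q" "a + b = a' + b'"
    \<comment> \<open>Both weights are minimal and the sums agree, so neither inequality is strict
      and the tie-breaking applies.\<close>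
    have "w a \<le> w a'" "w b \<le> w b'" using 1 a(2) b(2) by (auto intro: min_weight_le)
    moreover have "w a + w b = w a' + w b'" using 1(3) w by metis
    ultimately have "a \<le> a'" "b \<le> b'" using 1 a(3) b(3) by auto
    then show "a' = a \<and> b' = b"
      using 1(3) add_less_le_mono[of a a' b b'] add_le_less_mono[of a a' b b'] by force
  qed
  then have "a + b \<in> Poly_Mapping.keys (p * q)"
    using a(1) b(1) by (simp add: in_keys_iff)
  then show ?thesis
  proof (rule min_weight_eqI)
    show "w (a + b) = min_weight w p + min_weight w q" by (simp add: w a b)
    fix c assume "c \<in> Poly_Mapping.keys (p * q)"
    then obtain a' b' where "a' \<in> Poly_Mapping.keys p" "b' \<in> Poly_Mapping.keys q" "c = a' + b'"
      using keys_mult[of p q] by blast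
    then show "min_weight w p + min_weight w q \<le> w c"
      by (simp add: w add_mono min_weight_le)
  qed
qed

text \<open>Nonnegative coefficients cannot cancel, so the supports unite.\<close>

lemma min_weight_add:
  assumes "nonneg p" "nonneg q" "p \<noteq> 0" "q \<noteq> 0"
  shows "min_weight w (p + q) = min (min_weight w p) (min_weight w q)"
proof -
  have "Poly_Mapping.keys (p + q) = Poly_Mapping.keys p \<union> Poly_Mapping.keys q"
    using assms by (auto simp: in_keys_iff lookup_add nonneg_def add_nonneg_eq_0_iff)
  then show ?thesis
    using assms by (simp add: min_weight_def image_Un Min_Un)
qed

lemma min_weight_single: "c \<noteq> 0 \<Longrightarrow> min_weight w (Poly_Mapping.single a c) = w a"
  by (simp add: min_weight_def)

text \<open>A valuation on subtraction-free functions, phrased as a relation so that each closure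
  rule only has to exhibit one suitable fraction.\<close>

definition has_weight :: "(('n::linorder \<Rightarrow>\<^sub>0 int) \<Rightarrow> int) \<Rightarrow> 'n rat_fun \<Rightarrow> int \<Rightarrow> bool" where
  "has_weight w f v \<longleftrightarrow> (\<exists>p q. nonneg p \<and> p \<noteq> 0 \<and> nonneg q \<and> q \<noteq> 0 \<and> f = Fract p q \<and>
     v = min_weight w p - min_weight w q)"

lemma has_weight_nonzero: "has_weight w f v \<Longrightarrow> f \<noteq> 0"
  by (auto simp: has_weight_def Zero_fract_def eq_fract)

context
  fixes w :: "('n::linorder \<Rightarrow>\<^sub>0 int) \<Rightarrow> int"
  assumes w_add: "\<And>a b. w (a + b) = w a + w b"
begin

lemma has_weight_one: "has_weight w 1 0"
  unfolding has_weight_def One_fract_def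
  by (rule exI[of _ 1], rule exI[of _ 1]) (auto simp: nonneg_def lookup_one when_def)

lemma has_weight_indet: "has_weight w (indet i) (w (Poly_Mapping.single i 1))"
  unfolding has_weight_def indet_def
proof (intro exI conjI)
  show "nonneg (Poly_Mapping.single (Poly_Mapping.single i (1::int)) (1::rat))"
    by (auto simp: nonneg_def lookup_single when_def)
  show "Poly_Mapping.single (Poly_Mapping.single i (1::int)) (1::rat) \<noteq> 0"
    by (auto dest: arg_cong[where f = "\<lambda>p. Poly_Mapping.lookup p (Poly_Mapping.single i 1)"])
  show "nonneg (1 :: 'n laurent_poly)"
    by (auto simp: nonneg_def lookup_one when_def)
  have "w 0 = 0" using w_add[of 0 0] by simp
  then show "w (Poly_Mapping.single i 1) =
      min_weight w (Poly_Mapping.single (Poly_Mapping.single i (1::int)) (1::rat)) - min_weight w 1"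
    by (simp add: min_weight_single flip: single_one)
qed auto

lemma has_weight_mult:
  assumes "has_weight w f u" "has_weight w g v"
  shows "has_weight w (f * g) (u + v)"
proof -
  obtain p q where 1: "nonneg p" "p \<noteq> 0" "nonneg q" "q \<noteq> 0" "f = Fract p q"
      "u = min_weight w p - min_weight w q"
    using assms(1) unfolding has_weight_def by blast
  obtain p' q' where 2: "nonneg p'" "p' \<noteq> 0" "nonneg q'" "q' \<noteq> 0" "g = Fract p' q'"
      "v = min_weight w p' - min_weight w q'"
    using assms(2) unfolding has_weight_def by blast
  show ?thesis
    unfolding has_weight_def using 1 2
    by (intro exI[of _ "p * p'"] exI[of _ "q * q'"])
       (simp add: nonneg_mult min_weight_mult[OF w_add])
qed

lemma has_weight_divide:
  assumes "has_weight w f u" "has_weight w g v"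
  shows "has_weight w (f / g) (u - v)"
proof -
  obtain p q where 1: "nonneg p" "p \<noteq> 0" "nonneg q" "q \<noteq> 0" "g = Fract p q"
      "v = min_weight w p - min_weight w q"
    using assms(2) unfolding has_weight_def by blast
  then have "has_weight w (inverse g) (- v)"
    unfolding has_weight_def by (intro exI[of _ q] exI[of _ p]) simp
  from has_weight_mult[OF assms(1) this] show ?thesis
    by (simp add: divide_inverse)
qed

lemma has_weight_add:
  assumes "has_weight w f u" "has_weight w g v"
  shows "has_weight w (f + g) (min u v)"
proof -
  obtain p q where 1: "nonneg p" "p \<noteq> 0" "nonneg q" "q \<noteq> 0" "f = Fract p q"
      "u = min_weight w p - min_weight w q"
    using assms(1) unfolding has_weight_def by blast
  obtain p' q' where 2: "nonneg p'" "p' \<noteq> 0" "nonneg q'" "q' \<noteq> 0" "g = Fract p' q'"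
      "v = min_weight w p' - min_weight w q'"
    using assms(2) unfolding has_weight_def by blast
  show ?thesis
    unfolding has_weight_def using 1 2
    by (intro exI[of _ "p * q' + p' * q"] exI[of _ "q * q'"])
       (simp add: nonneg_mult nonneg_add nonneg_add_nonzero min_weight_mult[OF w_add]
         min_weight_add)
qed

lemma has_weight_power: "has_weight w f v \<Longrightarrow> has_weight w (f ^ m) (int m * v)"
proof (induction m)
  case (Suc m)
  then have "has_weight w (f * f ^ m) (v + int m * v)" by (intro has_weight_mult) auto
  then show ?case by (simp add: algebra_simps)
qed (simp add: has_weight_one)

text \<open>The signs of the coefficients of \<open>r\<close> are unknown, but
  \<open>p = r * q\<close> and multiplicativity of \<open>min_weight\<close> determine its
  weight.\<close>

lemma has_weight_Fract_1:
  assumes "has_weight w (Fract r 1) v"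
  shows "min_weight w r = v"
proof -
  obtain p q where 1: "p \<noteq> 0" "q \<noteq> 0" "Fract r 1 = Fract p q"
      "v = min_weight w p - min_weight w q"
    using assms unfolding has_weight_def by blast
  then have "p = r * q" by (simp add: eq_fract)
  with 1 show ?thesis by (simp add: min_weight_mult[OF w_add])
qed

end


section \<open>The Laurent phenomenon in rank 2\<close>

definition is_laurent :: "'n::linorder rat_fun \<Rightarrow> bool" where
  "is_laurent f \<longleftrightarrow> (\<exists>p. f = Fract p 1)"

lemma laurent_expansion_Fract: "laurent_expansion (Fract p 1) = p"
  unfolding laurent_expansion_def by (rule the_equality) (auto simp: eq_fract)

lemma is_laurent_one: "is_laurent 1"
  by (auto simp: is_laurent_def One_fract_def)

lemma is_laurent_add: "is_laurent f \<Longrightarrow> is_laurent g \<Longrightarrow> is_laurent (f + g)"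
  by (auto simp: is_laurent_def)

lemma is_laurent_diff: "is_laurent f \<Longrightarrow> is_laurent g \<Longrightarrow> is_laurent (f - g)"
  by (auto simp: is_laurent_def)

lemma is_laurent_mult: "is_laurent f \<Longrightarrow> is_laurent g \<Longrightarrow> is_laurent (f * g)"
  by (auto simp: is_laurent_def)

lemma is_laurent_power: "is_laurent f \<Longrightarrow> is_laurent (f ^ m)"
  by (induction m) (auto intro: is_laurent_one is_laurent_mult)

lemma is_laurent_indet: "is_laurent (indet i)"
  by (auto simp: is_laurent_def indet_def)

lemma is_laurent_inverse_indet: "is_laurent (1 / indet i)"
proof -
  let ?x = "Poly_Mapping.single (Poly_Mapping.single i (1::int)) (1::rat)"
  let ?y = "Poly_Mapping.single (Poly_Mapping.single i (- 1::int)) (1::rat)"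
  have "?y * ?x = 1" by (simp add: mult_single flip: single_add)
  moreover have "?x \<noteq> 0"
    by (auto dest: arg_cong[where f = "\<lambda>p. Poly_Mapping.lookup p (Poly_Mapping.single i 1)"])
  ultimately have "1 / indet i = Fract ?y 1"
    by (simp add: indet_def One_fract_def eq_fract)
  then show ?thesis by (auto simp: is_laurent_def)
qed

text \<open>The exponent \<open>Suc q\<close> is positive, so the base is 1 modulo \<open>a\<close>,
  and so are its powers.\<close>

lemma is_laurent_binomial:
  assumes "is_laurent a"
  shows "\<exists>r. is_laurent r \<and> (a ^ Suc q + 1) ^ p = 1 + a * r"
proof (induction p)
  case 0
  have "is_laurent (1 - 1 :: 'a rat_fun)" by (intro is_laurent_diff is_laurent_one)
  then show ?case by (intro exI[of _ 0]) simp
next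
  case (Suc p)
  then obtain r where "is_laurent r" "(a ^ Suc q + 1) ^ p = 1 + a * r" by blast
  then show ?case
    \<comment> \<open>The witness comes from expanding
      \<open>(1 + a * r) * (1 + a * a ^ q)\<close>.\<close>
    by (intro exI[of _ "a ^ q + r + a * r * a ^ q"] conjI)
       (auto simp: algebra_simps intro!: is_laurent_add is_laurent_mult is_laurent_power assms)
qed

text \<open>
  For four consecutive cluster variables \<open>b'\<close>, \<open>a\<close>, \<open>b\<close>, \<open>a'\<close> one has
  \<open>a'^p (b' b - 1) = (a' a)^p = (b^q + 1)^p\<close>, which is 1 modulo \<open>b\<close>. So \<open>b\<close> divides \<open>a'^p + 1\<close>.
\<close>

lemma is_laurent_next:
  assumes "a \<noteq> 0" "b \<noteq> 0" and L: "is_laurent b" "is_laurent ((b ^ q + 1) / a)"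
    "is_laurent ((a ^ p + 1) / b)" and pq: "p = 0 \<longleftrightarrow> q = 0"
  shows "is_laurent ((((b ^ q + 1) / a) ^ p + 1) / b)"
proof (cases q)
  case 0
  \<comment> \<open>Here \<open>p = 0\<close> by \<open>pq\<close>, so the claim and the last
    assumption of \<open>L\<close> both concern \<open>2 / b\<close>.\<close>
  then show ?thesis using assms by simp
next
  case (Suc q')
  define a' b' where "a' = (b ^ q + 1) / a" and "b' = (a ^ p + 1) / b"
  obtain r where r: "is_laurent r" "(b ^ q + 1) ^ p = 1 + b * r"
    using is_laurent_binomial[OF L(1)] Suc by blast
  have "a' ^ p * (b' * b - 1) = 1 + b * r"
    using \<open>a \<noteq> 0\<close> \<open>b \<noteq> 0\<close> by (simp add: a'_def b'_def power_divide flip: r(2))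
  then have "a' ^ p + 1 = b * (b' * a' ^ p - r)" by (simp add: algebra_simps)
  then have "(a' ^ p + 1) / b = b' * a' ^ p - r" using \<open>b \<noteq> 0\<close> by simp
  also have "is_laurent \<dots>"
    using L r by (intro is_laurent_diff is_laurent_mult is_laurent_power) (auto simp: a'_def b'_def)
  finally show ?thesis by (simp add: a'_def)
qed

section \<open>Exchange matrices and exchange relations in rank 2\<close>

definition opp :: "2 \<Rightarrow> 2" where
  "opp k = (if k = 1 then 2 else 1)"

lemma opp_neq [simp]: "opp k \<noteq> k" "k \<noteq> opp k"
  by (auto simp: opp_def)

lemma neq_iff_opp: "i \<noteq> k \<longleftrightarrow> i = opp k"
  using exhaust_2[of i] exhaust_2[of k] by (auto simp: opp_def)

lemma opp_opp [simp]: "opp (opp k) = k"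
  by (metis neq_iff_opp)

lemma UNIV_opp: "(UNIV :: 2 set) = {k, opp k}"
  using neq_iff_opp by auto

text \<open>Only the diagonal entry at \<open>opp k\<close> lies outside row and column
  \<open>k\<close>. It is 0, and its correction vanishes because the two off-diagonal entries have
  product at most 0.\<close>

lemma mutate_rank2:
  assumes "skew_symmetrizable (B :: 2 int_mat)"
  shows "mutate k B = - B"
proof -
  have "mutate k B $ i $ j = (- B) $ i $ j" for i j
  proof (cases "i = k \<or> j = k")
    case False
    then have "i = opp k" "j = opp k" by (auto simp: neq_iff_opp)
    moreover have "B $ opp k $ k * B $ k $ opp k \<le> 0"
    proof -
      obtain d :: "2 \<Rightarrow> int" where d: "\<And>i. d i > 0" "\<And>i j. d i * B $ i $ j = - (d j * B $ j $ i)"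
        using assms unfolding skew_symmetrizable_def by blast
      have "d k * (B $ opp k $ k * B $ k $ opp k) = - (d (opp k) * (B $ opp k $ k)\<^sup>2)"
        using arg_cong[OF d(2)[of k "opp k"], of "\<lambda>z. z * B $ opp k $ k"]
        by (simp add: power2_eq_square algebra_simps)
      also have "\<dots> \<le> 0" using d(1)[of "opp k"] by simp
      finally show ?thesis using d(1)[of k] by (simp add: mult_le_0_iff)
    qed
    ultimately show ?thesis
      by (simp add: mutate_def pos_part_def skew_symmetrizable_diag[OF assms])
  qed (simp add: mutate_def)
  then show ?thesis by (simp add: vec_eq_iff)
qed

lemma skew_symmetrizable_uminus:
  assumes "skew_symmetrizable B"
  shows "skew_symmetrizable (- B)"
proof -
  obtain d :: "'a \<Rightarrow> int" where d: "\<And>i. d i > 0" "\<And>i j. d i * B $ i $ j = - (d j * B $ j $ i)"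
    using assms unfolding skew_symmetrizable_def by blast
  have "d i * (- B) $ i $ j = - (d j * (- B) $ j $ i)" for i j
    using d(2)[of i j] by simp
  with d(1) show ?thesis unfolding skew_symmetrizable_def by blast
qed

text \<open>Transposing inverts the symmetrizing weights; for two weights this is, up to a common
  factor, swapping them, which keeps them integral.\<close>

lemma skew_symmetrizable_transpose_rank2:
  assumes "skew_symmetrizable (B :: 2 int_mat)"
  shows "skew_symmetrizable (transpose B)"
proof -
  obtain d :: "2 \<Rightarrow> int" where d: "\<And>i. d i > 0" "\<And>i j. d i * B $ i $ j = - (d j * B $ j $ i)"
    using assms unfolding skew_symmetrizable_def by blast
  have "d (opp i) * transpose B $ i $ j = - (d (opp j) * transpose B $ j $ i)" for i j
  proof (cases "i = j")
    case False
    then have "opp i = j" "opp j = i" using neq_iff_opp by auto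
    then show ?thesis using d(2)[of i j] by (simp add: transpose_def)
  qed (simp add: transpose_def skew_symmetrizable_diag[OF assms])
  with d(1) show ?thesis unfolding skew_symmetrizable_def by (intro exI[of _ "\<lambda>i. d (opp i)"]) blast
qed

lemma skew_symmetrizable_eq_0_iff:
  assumes "skew_symmetrizable B"
  shows "B $ i $ j = 0 \<longleftrightarrow> B $ j $ i = 0"
proof -
  obtain d :: "'a \<Rightarrow> int" where d: "\<And>i. d i > 0" "\<And>i j. d i * B $ i $ j = - (d j * B $ j $ i)"
    using assms unfolding skew_symmetrizable_def by blast
  show ?thesis
    using d(2)[of i j] d(1)[of i] d(1)[of j]
    by (metis mult_eq_0_iff neg_equal_0_iff_equal less_irrefl)
qed

text \<open>One of the two positive parts is 0, so one monomial is 1, and the sign of the entry only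
  decides which.\<close>

lemma exchange_rhs_rank2:
  assumes "skew_symmetrizable (B :: 2 int_mat)"
  shows "exchange_rhs k B x = x (opp k) ^ nat \<bar>B $ opp k $ k\<bar> + 1"
  by (auto simp: exchange_rhs_def UNIV_opp[of k] skew_symmetrizable_diag[OF assms] pos_part_def
      abs_if max_def)

text \<open>An induction invariant: it includes the variables one mutation away in both directions,
  so that it covers the four consecutive variables of \<open>is_laurent_next\<close>.\<close>

definition laurent_seed :: "2 seed \<Rightarrow> bool" where
  "laurent_seed s \<longleftrightarrow> good_seed s \<and> (\<forall>k. is_laurent (snd s k) \<and> is_laurent (snd (mutate_seed k s) k))"

lemma laurent_seed_mutate:
  assumes "laurent_seed s"
  shows "laurent_seed (mutate_seed k s)"
proof (cases s)
  case (Pair B x)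
  let ?l = "opp k"
  have s: "good_seed s" using assms by (simp add: laurent_seed_def)
  then have B: "skew_symmetrizable B" and nz: "\<And>i. x i \<noteq> 0"
    by (auto simp: good_seed_def Pair subtraction_free_nonzero)
  have xL: "is_laurent (x i)" for i using assms by (auto simp: laurent_seed_def Pair)
  have muL: "is_laurent ((x (opp i) ^ nat \<bar>B $ opp i $ i\<bar> + 1) / x i)" for i
    using assms by (auto simp: laurent_seed_def Pair mutate_seed_def exchange_rhs_rank2[OF B])
  \<comment> \<open>This is \<open>is_laurent_next\<close> with \<open>x k\<close> as
    \<open>a\<close> and \<open>x ?l\<close> as \<open>b\<close>; the exponents vanish together by
    skew-symmetrizability.\<close>
  have "is_laurent ((((x ?l ^ nat \<bar>B $ ?l $ k\<bar> + 1) / x k) ^ nat \<bar>B $ k $ ?l\<bar> + 1) / x ?l)"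
    using muL[of k] muL[of ?l] skew_symmetrizable_eq_0_iff[OF B, of k ?l]
    by (intro is_laurent_next nz xL) auto
  then have l: "is_laurent (snd (mutate_seed ?l (mutate_seed k s)) ?l)"
    by (simp add: Pair mutate_seed_def mutate_rank2[OF B]
        exchange_rhs_rank2[OF B] exchange_rhs_rank2[OF skew_symmetrizable_uminus[OF B]])
  have "is_laurent (snd (mutate_seed k s) i)" for i
    using xL muL[of k] by (cases "i = k") (auto simp: Pair mutate_seed_def exchange_rhs_rank2[OF B])
  moreover have "is_laurent (snd (mutate_seed i (mutate_seed k s)) i)" for i
  proof (cases "i = k")
    case True
    then show ?thesis using mutate_seed_mutate_seed[OF s] xL by (simp add: Pair)
  next
    case False
    then show ?thesis using l by (simp add: neq_iff_opp)
  qed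
  ultimately show ?thesis
    using good_seed_mutate[OF s] by (simp add: laurent_seed_def)
qed

lemma is_laurent_cluster_var:
  assumes B: "skew_symmetrizable (B :: 2 int_mat)"
  shows "is_laurent (cluster_var E B t0 t j)"
proof -
  have "is_laurent ((indet (opp k) ^ m + 1) * (1 / indet k))" for k :: 2 and m
    by (intro is_laurent_mult is_laurent_add is_laurent_power is_laurent_one
        is_laurent_inverse_indet is_laurent_indet)
  then have "laurent_seed (B, indet)"
    by (simp add: laurent_seed_def good_seed_def B subtraction_free_indet is_laurent_indet
        mutate_seed_def exchange_rhs_rank2)
  then have "laurent_seed (fold mutate_seed ks (B, indet))" for ks
    by (induction ks rule: rev_induct) (auto intro: laurent_seed_mutate)
  then show ?thesis by (simp add: cluster_var_def seed_def laurent_seed_def)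
qed


section \<open>Tropical mutation\<close>

text \<open>\<open>u\<close> holds negated weights, so addition becomes a maximum; its 0 comes from
  the monomial 1.\<close>

definition trop :: "(2 \<Rightarrow> 2 \<Rightarrow> int) \<Rightarrow> 2 \<Rightarrow> (2 \<Rightarrow> int) \<Rightarrow> 2 \<Rightarrow> int" where
  "trop A k u = u(k := max (A (opp k) k * u (opp k)) 0 - u k)"

definition abs_entries :: "2 int_mat \<Rightarrow> 2 \<Rightarrow> 2 \<Rightarrow> int" where
  "abs_entries B i j = \<bar>B $ i $ j\<bar>"

lemma abs_entries_uminus [simp]: "abs_entries (- B) = abs_entries B"
  by (simp add: abs_entries_def fun_eq_iff)

lemma has_weight_mutate:
  assumes w: "\<And>a b. w (a + b) = w a + w b" and B: "skew_symmetrizable B"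
    and x: "\<And>j. has_weight w (x j) (- u j)"
  shows "has_weight w (snd (mutate_seed k (B, x)) j) (- trop (abs_entries B) k u j)"
proof (cases "j = k")
  case True
  let ?m = "nat \<bar>B $ opp k $ k\<bar>"
  have "has_weight w ((x (opp k) ^ ?m + 1) / x k) (min (int ?m * - u (opp k)) 0 - - u k)"
    by (intro has_weight_divide has_weight_add has_weight_power has_weight_one w x)
  also have "min (int ?m * - u (opp k)) 0 - - u k = - trop (abs_entries B) k u k"
    by (simp add: trop_def abs_entries_def)
  finally show ?thesis using True by (simp add: mutate_seed_def exchange_rhs_rank2[OF B])
next
  case False
  then show ?thesis using x by (simp add: mutate_seed_def trop_def)
qed

lemma has_weight_fold:
  assumes w: "\<And>a b. w (a + b) = w a + w b"
  shows "skew_symmetrizable B \<Longrightarrow> (\<And>j. has_weight w (x j) (- u j)) \<Longrightarrow>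
    has_weight w (snd (fold mutate_seed ks (B, x)) j) (- fold (trop (abs_entries B)) ks u j)"
proof (induction ks arbitrary: B x u)
  case (Cons k ks)
  let ?x = "snd (mutate_seed k (B, x))"
  have "mutate_seed k (B, x) = (- B, ?x)"
    using Cons.prems(1) by (simp add: mutate_seed_def mutate_rank2)
  moreover have "has_weight w (?x j) (- trop (abs_entries B) k u j)" for j
    by (intro has_weight_mutate w Cons.prems)
  with Cons.IH[of "- B" ?x "trop (abs_entries B) k u"] Cons.prems(1)
  have "has_weight w (snd (fold mutate_seed ks (- B, ?x)) j)
      (- fold (trop (abs_entries B)) ks (trop (abs_entries B) k u) j)"
    by (simp add: skew_symmetrizable_uminus)
  ultimately show ?case by simp
qed simp

text \<open>Taking the exponent of \<open>x\<^sub>i\<close> as valuation, row \<open>i\<close>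
  evolves on its own, starting from row \<open>i\<close> of minus the identity.\<close>

lemma D_mat_trop:
  assumes "skew_symmetrizable B"
  shows "D_mat E B t0 t $ i $ j =
    fold (trop (abs_entries B)) (tree_path E t0 t) (\<lambda>l. if l = i then - 1 else 0) j"
proof -
  let ?w = "\<lambda>a. Poly_Mapping.lookup a i"
  let ?v = "fold (trop (abs_entries B)) (tree_path E t0 t) (\<lambda>l. if l = i then - 1 else 0) j"
  have w: "?w (a + b) = ?w a + ?w b" for a b :: "2 \<Rightarrow>\<^sub>0 int" by (simp add: lookup_add)
  have "has_weight ?w (indet l) (- (if l = i then - 1 else 0))" for l
    using has_weight_indet[of ?w, OF w, of l] by (simp add: lookup_single when_def split: if_splits)
  from has_weight_fold[of ?w, OF w assms this]
  have "has_weight ?w (cluster_var E B t0 t j) (- ?v)"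
    by (simp add: cluster_var_def seed_def)
  moreover obtain r where r: "cluster_var E B t0 t j = Fract r 1"
    using is_laurent_cluster_var[OF assms, of E t0 t j] unfolding is_laurent_def by blast
  ultimately have "min_weight ?w r = - ?v"
    using has_weight_Fract_1[of ?w, OF w] by simp
  then show ?thesis
    by (simp add: D_mat_def r laurent_expansion_Fract lowest_power_def min_weight_def)
qed

text \<open>The negated exponent of \<open>x\<^sub>i\<close> is a valuation as well; it flips the
  sign of the start vector and leaves the recursion unchanged.\<close>

lemma M_mat_trop:
  assumes "skew_symmetrizable B"
  shows "M_mat E B t0 t $ i $ j =
    fold (trop (abs_entries B)) (tree_path E t0 t) (\<lambda>l. if l = i then 1 else 0) j"
proof -
  let ?w = "\<lambda>a. - Poly_Mapping.lookup a i"
  let ?v = "fold (trop (abs_entries B)) (tree_path E t0 t) (\<lambda>l. if l = i then 1 else 0) j"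
  have w: "?w (a + b) = ?w a + ?w b" for a b :: "2 \<Rightarrow>\<^sub>0 int" by (simp add: lookup_add)
  have "has_weight ?w (indet l) (- (if l = i then 1 else 0))" for l
    using has_weight_indet[of ?w, OF w, of l] by (simp add: lookup_single when_def split: if_splits)
  from has_weight_fold[of ?w, OF w assms this]
  have hw: "has_weight ?w (cluster_var E B t0 t j) (- ?v)"
    by (simp add: cluster_var_def seed_def)
  obtain r where r: "cluster_var E B t0 t j = Fract r 1"
    using is_laurent_cluster_var[OF assms, of E t0 t j] unfolding is_laurent_def by blast
  with hw have "min_weight ?w r = - ?v"
    using has_weight_Fract_1[of ?w, OF w] by simp
  moreover have "min_weight ?w r = - highest_power i r"
  proof -
    let ?S = "(\<lambda>a. Poly_Mapping.lookup a i) ` Poly_Mapping.keys r"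
    have "Poly_Mapping.keys r \<noteq> {}"
      using has_weight_nonzero[OF hw] by (auto simp: r Zero_fract_def)
    then have "Max ?S \<in> ?S" by (intro Max_in) auto
    then obtain a where "a \<in> Poly_Mapping.keys r" "Poly_Mapping.lookup a i = Max ?S" by force
    then show ?thesis
      unfolding highest_power_def by (intro min_weight_eqI[of a]) auto
  qed
  ultimately show ?thesis
    by (simp add: M_mat_def r laurent_expansion_Fract)
qed

lemma trop_trop: "trop A k (trop A k u) = u"
  by (simp add: trop_def fun_eq_iff)

section \<open>Paths under reversal and under a step at one end\<close>

lemma tree_path_rev:
  assumes E: "regular_labeled_tree E"
  shows "tree_path E t' t = rev (tree_path E t t')"
proof (rule tree_path_eqI[OF E])
  show "distinct_adj (rev (tree_path E t t'))"
    using tree_path(1)[OF E] by (simp add: distinct_adj_rev)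
  have sym: "E v k u" if "E u k v" for u k v
    using that E unfolding regular_labeled_tree_def by blast
  show "walk E t' (rev (tree_path E t t')) t"
    by (rule walk_sym[OF sym tree_path(2)[OF E]])
qed

text \<open>Prepending \<open>k\<close> to the path from \<open>t1\<close> avoids backtracking
  unless that path starts with \<open>k\<close>; then its first edge leads to \<open>t0\<close> and
  the rest is the path from \<open>t0\<close>.\<close>

lemma tree_path_edge:
  assumes E: "regular_labeled_tree E" and e: "E t0 k t1"
  shows "tree_path E t0 t = k # tree_path E t1 t \<or> tree_path E t1 t = k # tree_path E t0 t"
proof (cases "tree_path E t1 t \<noteq> [] \<and> hd (tree_path E t1 t) = k")
  case False
  then have "distinct_adj (k # tree_path E t1 t)"
    using tree_path(1)[OF E, of t1 t] by (auto simp: distinct_adj_Cons)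
  then have "tree_path E t0 t = k # tree_path E t1 t"
    using e tree_path(2)[OF E, of t1 t] by (intro tree_path_eqI[OF E]) auto
  then show ?thesis ..
next
  case True
  then obtain q where q: "tree_path E t1 t = k # q" by (metis list.collapse)
  then obtain s where s: "E t1 k s" "walk E s q t"
    using tree_path(2)[OF E, of t1 t] by auto
  have "E t1 k t0" using e E unfolding regular_labeled_tree_def by blast
  then have "s = t0" using s(1) E unfolding regular_labeled_tree_def by blast
  moreover have "distinct_adj q"
    using tree_path(1)[OF E, of t1 t] unfolding q by (rule distinct_adj_ConsD)
  ultimately have "tree_path E t0 t = q"
    using s(2) by (intro tree_path_eqI[OF E]) auto
  then show ?thesis using q by simp
qed

text \<open>If the step shortens the path, it undoes the last mutation, and \<open>trop\<close> is
  an involution.\<close>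

lemma D_mat_edge:
  assumes E: "regular_labeled_tree E" and B: "skew_symmetrizable B" and e: "E t k t'"
  shows "D_mat E B t0 t' $ i $ j = trop (abs_entries B) k (\<lambda>l. D_mat E B t0 t $ i $ l) j"
  using tree_path_edge[OF E e, of t0]
  by (auto simp: D_mat_trop[OF B] tree_path_rev[OF E, of t0] trop_trop)


section \<open>Duality of denominator vectors\<close>

text \<open>With two labels, every path without backtracking has a label list of this form.\<close>

primrec alternating :: "2 \<Rightarrow> nat \<Rightarrow> 2 list" where
  "alternating k 0 = []"
| "alternating k (Suc m) = k # alternating (opp k) m"

lemma alternating_snoc:
  "alternating k (Suc m) = alternating k m @ [if even m then k else opp k]"
proof (induction m arbitrary: k)
  case (Suc m)
  have "alternating k (Suc (Suc m)) = k # alternating (opp k) (Suc m)" by simp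
  also have "\<dots> = k # alternating (opp k) m @ [if even m then opp k else opp (opp k)]"
    unfolding Suc.IH ..
  finally show ?case by simp
qed simp

lemma rev_alternating: "rev (alternating k m) = alternating (if even m then opp k else k) m"
proof (induction m arbitrary: k)
  case (Suc m)
  show ?case by (subst alternating_snoc) (simp add: Suc)
qed simp

lemma distinct_adj_alternating:
  assumes "distinct_adj ks"
  shows "\<exists>k m. ks = alternating k m"
proof -
  have "ks = alternating (hd ks) (length ks)" using assms
  proof (induction ks)
    case (Cons k ks)
    show ?case
    proof (cases ks)
      case (Cons a list)
      then have "a = opp k"
        using Cons.prems by (auto simp: neq_iff_opp)
      then show ?thesis using Cons.IH Cons.prems Cons by simp
    qed simp
  qed simp
  then show ?thesis by blast
qed

text \<open>
  The denominator of the initial variable mutated first, along an alternating path: before step \<open>m\<close>,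
  the variable about to be mutated has entry \<open>dchain b c m\<close> and the other \<open>dchain b c (m + 1)\<close>.
\<close>

fun dchain :: "int \<Rightarrow> int \<Rightarrow> nat \<Rightarrow> int" where
  "dchain b c 0 = - 1"
| "dchain b c (Suc 0) = 0"
| "dchain b c (Suc (Suc m)) =
     max ((if even m then c else b) * dchain b c (Suc m)) 0 - dchain b c m"

text \<open>
  Swapping \<open>b\<close> and \<open>c\<close> fixes the even terms and rescales the odd ones. No distinction between finite
  and infinite type is needed.
\<close>

lemma dchain_swap_aux:
  assumes "b \<ge> 0" "c \<ge> 0"
  shows "dchain b c (2 * m) = dchain c b (2 * m) \<and>
    c * dchain b c (Suc (2 * m)) = b * dchain c b (Suc (2 * m))"
proof (induction m)
  case (Suc m)
  let ?n = "Suc (Suc (2 * m))"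
  \<comment> \<open>The recursion multiplies the odd term by \<open>c\<close>, which is exactly the
    product controlled by the induction hypothesis.\<close>
  have 1: "dchain b c ?n = dchain c b ?n" using Suc by simp
  have 2: "dchain b c (Suc ?n) = max (b * dchain b c ?n) 0 - dchain b c (Suc (2 * m))" for b c
    by (subst dchain.simps(3)) simp
  \<comment> \<open>Both sides are \<open>max (b * c * y) 0\<close>, as \<open>b\<close> and
    \<open>c\<close> are nonnegative.\<close>
  have "c * max (b * y) 0 = b * max (c * y) 0" for y
    using assms by (simp add: max_mult_distrib_left mult.left_commute)
  with Suc have "c * dchain b c (Suc ?n) = b * dchain c b (Suc ?n)"
    unfolding 2 1 by (simp only: right_diff_distrib)
  with 1 show ?case by simp
qed simp

lemma dchain_swap: "b \<ge> 0 \<Longrightarrow> c \<ge> 0 \<Longrightarrow> even m \<Longrightarrow> dchain b c m = dchain c b m"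
  using dchain_swap_aux by (auto elim!: evenE)

definition dvec :: "(2 \<Rightarrow> 2 \<Rightarrow> int) \<Rightarrow> 2 list \<Rightarrow> 2 \<Rightarrow> 2 \<Rightarrow> int" where
  "dvec A ks i = fold (trop A) ks (\<lambda>l. if l = i then - 1 else 0)"

lemma dvec_snoc: "dvec A (ks @ [k]) i = trop A k (dvec A ks i)"
  by (simp add: dvec_def)

lemma dvec_alternating_first:
  "dvec A (alternating k m) k = (\<lambda>j. if j = (if even m then k else opp k)
     then dchain (A k (opp k)) (A (opp k) k) m else dchain (A k (opp k)) (A (opp k) k) (Suc m))"
proof (induction m)
  case (Suc m)
  show ?case
    unfolding alternating_snoc dvec_snoc Suc.IH
    by (cases "even m") (auto simp: trop_def fun_eq_iff neq_iff_opp)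
qed (auto simp: dvec_def)

text \<open>The first mutation leaves this start vector unchanged, as a nonnegative entry times -1
  has positive part 0. What remains is the chain of the path starting with \<open>opp k\<close>: one
  step shorter, coefficients interchanged.\<close>

lemma dvec_alternating_second:
  assumes "A (opp k) k \<ge> 0"
  shows "dvec A (alternating k (Suc m)) (opp k) = (\<lambda>j. if j = (if even m then opp k else k)
     then dchain (A (opp k) k) (A k (opp k)) m else dchain (A (opp k) k) (A k (opp k)) (Suc m))"
proof (induction m)
  case 0
  then show ?case using assms by (auto simp: dvec_def trop_def fun_eq_iff neq_iff_opp)
next
  case (Suc m)
  show ?case
    unfolding alternating_snoc[of k "Suc m"] dvec_snoc Suc.IH
    by (cases "even m") (auto simp: trop_def fun_eq_iff neq_iff_opp)
qed

text \<open>Both sides are chain entries with the same index. At an odd index the chains agree; at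
  an even index they differ by interchanging the coefficients, which \<open>dchain_swap\<close>
  absorbs.\<close>

lemma dvec_dual:
  assumes A: "\<And>i j. A i j \<ge> 0" and ks: "distinct_adj ks"
  shows "dvec A ks i j = dvec (\<lambda>i j. A j i) (rev ks) j i"
proof -
  obtain k m where km: "ks = alternating k m" using distinct_adj_alternating[OF ks] by blast
  show ?thesis
  proof (cases m)
    case 0
    then show ?thesis by (simp add: km dvec_def)
  next
    case (Suc n)
    let ?A = "\<lambda>i j. A j i"
    note first = dvec_alternating_first[of A _ m] dvec_alternating_first[of ?A _ m]
    note second = dvec_alternating_second[of A _ n, OF A, folded Suc]
      dvec_alternating_second[of ?A _ n, OF A, folded Suc]
    note swap = dchain_swap[of "A k (opp k)" "A (opp k) k", OF A A]
    have "i = k \<or> i = opp k" "j = k \<or> j = opp k" using neq_iff_opp by auto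
    moreover have "even n \<longleftrightarrow> odd m" using Suc by simp
    ultimately show ?thesis
      unfolding km rev_alternating
      using first(1)[of k] first(2)[of k] first(2)[of "opp k"]
        second(1)[of k] second(2)[of k] second(2)[of "opp k"] swap[of m] swap[of n] swap[of "Suc m"]
      by (cases "even m") auto
  qed
qed

section \<open>Property D and change of the initial vertex\<close>

lemma abs_entries_transpose: "abs_entries (transpose B) = (\<lambda>i j. abs_entries B j i)"
  by (simp add: abs_entries_def transpose_def fun_eq_iff)

text \<open>Only absolute values of the entries enter the denominators, so \<open>B'\<close> is left
  free up to signs to fit the exchange matrix at either vertex.\<close>

lemma D_mat_dual:
  assumes E: "regular_labeled_tree E" and B: "skew_symmetrizable B"
    and B': "skew_symmetrizable B'" "abs_entries B' = abs_entries (transpose B)"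
  shows "D_mat E B' t t0 $ j $ i = D_mat E B t0 t $ i $ j"
proof -
  have "dvec (abs_entries B) (tree_path E t0 t) i j =
      dvec (\<lambda>i j. abs_entries B j i) (rev (tree_path E t0 t)) j i"
    by (rule dvec_dual) (simp_all add: abs_entries_def tree_path(1)[OF E])
  then show ?thesis
    by (simp add: D_mat_trop[OF B] D_mat_trop[OF B'(1)] B'(2) abs_entries_transpose
        tree_path_rev[OF E, of t0 t] dvec_def)
qed

text \<open>Dualize, so that the initial step becomes a terminal one, apply
  \<open>D_mat_edge\<close>, and dualize back.\<close>

lemma D_mat_initial_edge:
  assumes E: "regular_labeled_tree E" and B: "skew_symmetrizable B" and e: "E t0 k t1"
    and B': "skew_symmetrizable B'" "abs_entries B' = abs_entries B"
  shows "D_mat E B' t1 t $ i $ j =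
    (if i = k then max (\<bar>B $ k $ opp k\<bar> * D_mat E B t0 t $ opp k $ j) 0 - D_mat E B t0 t $ k $ j
     else D_mat E B t0 t $ i $ j)"
proof -
  have C: "skew_symmetrizable (transpose B)"
    by (rule skew_symmetrizable_transpose_rank2[OF B])
  have "D_mat E B' t1 t $ i $ j = D_mat E (transpose B) t t1 $ j $ i"
    by (rule D_mat_dual[OF E C B'(1), of t1 t]) (simp add: B' transpose_transpose)
  also have "\<dots> = trop (abs_entries (transpose B)) k (\<lambda>l. D_mat E (transpose B) t t0 $ j $ l) i"
    by (rule D_mat_edge[OF E C e])
  also have "\<dots> = trop (abs_entries (transpose B)) k (\<lambda>l. D_mat E B t0 t $ l $ j) i"
    by (subst D_mat_dual[OF E B C refl]) simp
  finally show ?thesis by (simp add: trop_def abs_entries_transpose abs_entries_def)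
qed

text \<open>
  Tropically, substituting the exchange relation for \<open>x\<^sub>i\<close> exchanges the start vectors of
  highest powers at \<open>t0\<close> and of denominators at \<open>t1\<close>.
\<close>

lemma M_mat_eq_D_mat_neighbour:
  assumes E: "regular_labeled_tree E" and B: "skew_symmetrizable (B :: 2 int_mat)"
    and e: "E t0 i t1"
  shows "M_mat E B t0 t $ i $ j = D_mat E B t1 t $ i $ j"
proof -
  \<comment> \<open>The entry at \<open>opp i\<close> is 0, so the maximum vanishes.
    \<open>c = 1\<close> serves if the path from \<open>t0\<close> passes through \<open>t1\<close>,
    and \<open>c = - 1\<close> in the opposite case.\<close>
  have "trop (abs_entries B) i (\<lambda>l. if l = i then c else 0) = (\<lambda>l. if l = i then - c else 0)" for c
    by (auto simp: trop_def)
  from this[of 1] this[of "- 1", unfolded minus_minus] show ?thesis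
    using tree_path_edge[OF E e, of t] by (auto simp: M_mat_trop[OF B] D_mat_trop[OF B])
qed

section \<open>From the tropical recursion to the matrix identities\<close>

lemma abs_entries_exch_mat:
  assumes "skew_symmetrizable (B :: 2 int_mat)"
  shows "abs_entries (exch_mat E B t0 t) = abs_entries B"
proof -
  have "fst (fold mutate_seed ks (B, x)) \<in> {B, - B}" for ks x
    by (induction ks rule: rev_induct)
       (auto simp: mutate_seed_def mutate_rank2[OF assms]
         mutate_rank2[OF skew_symmetrizable_uminus[OF assms]] split: prod.splits)
  from this[of "tree_path E t0 t" indet] show ?thesis
    by (auto simp: exch_mat_def seed_def)
qed

lemma matrix_mult_rank2:
  fixes A D :: "2 int_mat"
  shows "(A ** D) $ i $ j = A $ i $ k * D $ k $ j + A $ i $ opp k * D $ opp k $ j"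
  by (simp add: matrix_matrix_mult_def UNIV_opp[of k])

text \<open>One part is 0 and the other is the absolute value; this turns the maxima in Properties R
  and M into that of \<open>trop\<close>.\<close>

lemma max_pos_part: "max (pos_part b * y) (pos_part (- b) * y) = max (\<bar>b\<bar> * y) 0"
  by (auto simp: pos_part_def max_def mult_le_0_iff zero_le_mult_iff)

theorem theorem1p2:
  fixes E :: "'v \<Rightarrow> 2 \<Rightarrow> 'v \<Rightarrow> bool"
    and B0 :: "int ^ 2 ^ 2" and s0 :: 'v
    and B :: "'v \<Rightarrow> int ^ 2 ^ 2"
  assumes tree: "regular_labeled_tree E"
    and skew: "skew_symmetrizable B0"
    and B: "B = exch_mat E B0 s0"
  shows
    "(\<forall>t0 t. transpose (D_mat E (B t0) t0 t) = D_mat E (transpose (- B t)) t t0) \<and>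
     (\<forall>t0 t t1 k. E t0 k t1 \<longrightarrow>
        D_mat E (B t1) t1 t = J_mat k ** D_mat E (B t0) t0 t +
          mat_max (mat_pos_part (row_only k (B t0)) ** D_mat E (B t0) t0 t)
                  (mat_pos_part (- row_only k (B t0)) ** D_mat E (B t0) t0 t)) \<and>
     (\<forall>t0 t. M_mat E (B t0) t0 t = - D_mat E (B t0) t0 t +
        mat_max (mat_pos_part (B t0) ** D_mat E (B t0) t0 t)
                (mat_pos_part (- B t0) ** D_mat E (B t0) t0 t))"
proof (intro conjI allI impI)
  have sk: "skew_symmetrizable (B t)" for t
    using good_seed_seed[OF skew, of E s0 t] by (simp add: B exch_mat_def good_seed_def)
  have ab: "abs_entries (B t) = abs_entries (B t')" for t t'
    by (simp add: B abs_entries_exch_mat[OF skew])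
  note diag = skew_symmetrizable_diag[OF sk]
  show "transpose (D_mat E (B t0) t0 t) = D_mat E (transpose (- B t)) t t0" for t0 t
  proof -
    \<comment> \<open>\<open>B t\<close> and \<open>B t0\<close> agree up to sign, which is all that
      \<open>D_mat_dual\<close> asks of the transposed matrix.\<close>
    have "D_mat E (transpose (- B t)) t t0 $ j $ i = D_mat E (B t0) t0 t $ i $ j" for i j
      by (rule D_mat_dual[OF tree sk])
         (simp_all add: skew_symmetrizable_transpose_rank2 skew_symmetrizable_uminus sk
           abs_entries_transpose ab[of t t0])
    then show ?thesis by (simp add: vec_eq_iff transpose_def)
  qed
  show "D_mat E (B t1) t1 t = J_mat k ** D_mat E (B t0) t0 t +
      mat_max (mat_pos_part (row_only k (B t0)) ** D_mat E (B t0) t0 t)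
              (mat_pos_part (- row_only k (B t0)) ** D_mat E (B t0) t0 t)"
    if e: "E t0 k t1" for t0 t t1 k
    unfolding vec_eq_iff
  proof (intro allI)
    fix i j
    show "D_mat E (B t1) t1 t $ i $ j = (J_mat k ** D_mat E (B t0) t0 t +
      mat_max (mat_pos_part (row_only k (B t0)) ** D_mat E (B t0) t0 t)
              (mat_pos_part (- row_only k (B t0)) ** D_mat E (B t0) t0 t)) $ i $ j"
      \<comment> \<open>Outside row \<open>k\<close> the maximum is 0; in row \<open>k\<close> the
        zero diagonal of \<open>B t0\<close> leaves one product.\<close>
      unfolding D_mat_initial_edge[OF tree sk[of t0] e sk[of t1] ab]
      by (cases "i = k")
         (auto simp: mat_max_def matrix_mult_rank2[where k = k] J_mat_def mat_pos_part_def
           row_only_def diag max_pos_part neq_iff_opp pos_part_def[of 0])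
  qed
  show "M_mat E (B t0) t0 t = - D_mat E (B t0) t0 t +
      mat_max (mat_pos_part (B t0) ** D_mat E (B t0) t0 t)
              (mat_pos_part (- B t0) ** D_mat E (B t0) t0 t)" for t0 t
    unfolding vec_eq_iff
  proof (intro allI)
    fix i j
    obtain t1 where e: "E t0 i t1"
      using tree unfolding regular_labeled_tree_def by blast
    show "M_mat E (B t0) t0 t $ i $ j = (- D_mat E (B t0) t0 t +
      mat_max (mat_pos_part (B t0) ** D_mat E (B t0) t0 t)
              (mat_pos_part (- B t0) ** D_mat E (B t0) t0 t)) $ i $ j"
      unfolding M_mat_eq_D_mat_neighbour[OF tree sk e] D_mat_initial_edge[OF tree sk e sk refl]
      by (simp add: mat_max_def matrix_mult_rank2[where k = i] mat_pos_part_def diag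
          max_pos_part pos_part_def[of 0])
  qed
qed

end
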